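(* Let $S_4$ be the symmetric group on four letters, and let $\mathcal S(S_4)$ denote the set of integers $\det\big(x_{g_i g_j^{-1}}\big)_{1\le i,j\le 24}$ obtained as $(x_g)_{g\in S_4}$ ranges over all assignments of integers to the elements of $S_4$ (where $g_1,\dots,g_{24}$ is an enumeration of $S_4$). Then: (i) the odd integers in $\mathcal S(S_4)$ are exactly the integers $m\equiv 1 \pmod 4$ such that $3\nmid m$ or $3^3\mid m$; (ii) the even integers in $\mathcal S(S_4)$ are exactly the integers of the form $2^8 m$ with $m\equiv 1\pmod 4$, or $2^{10}m$ with $m\equiv -1\pmod 4$, or $2^{12}m$ with $m$ any integer, where in each case $m$ is an integer satisfying $3\nmid m$ or $3^3\mid m$.
   Context: For a finite group $G=\{g_1,\ldots,g_n\}$ with variables $x_g$ ($g\in G$), the group determinant $\mathscr D_G$ is the determinant of the $n\times n$ matrix whose $(i,j)$ entry is $x_{g_ig_j^{-1}}$. The set $\mathcal S(G)$ is the set of values of $\mathscr D_G$ when all $x_g$ are integers. *)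

theory Defs
  imports
    "HOL-Algebra.Sym_Groups"
    "HOL-Number_Theory.Cong"
    "Jordan_Normal_Form.Determinant"
begin

text \<open>
  The enumeration \<open>g\<close> of the group is indexed by \<open>{..<n}\<close> instead of \<open>{1..n}\<close>, in line with the
  zero-based indexing of \<^typ>\<open>'a mat\<close>.
\<close>

definition group_enumeration :: "('g, 'm) monoid_scheme \<Rightarrow> (nat \<Rightarrow> 'g) \<Rightarrow> bool" where
  "group_enumeration G g \<longleftrightarrow> bij_betw g {..<Coset.order G} (carrier G)"

definition group_matrix ::
    "('g, 'm) monoid_scheme \<Rightarrow> (nat \<Rightarrow> 'g) \<Rightarrow> ('g \<Rightarrow> 'a) \<Rightarrow> 'a mat" where
  "group_matrix G g x =
     mat (Coset.order G) (Coset.order G) (\<lambda>(i, j). x (g i \<otimes>\<^bsub>G\<^esub> inv\<^bsub>G\<^esub> (g j)))"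

definition group_det ::
    "('g, 'm) monoid_scheme \<Rightarrow> (nat \<Rightarrow> 'g) \<Rightarrow> ('g \<Rightarrow> 'a :: comm_ring_1) \<Rightarrow> 'a" where
  "group_det G g x = det (group_matrix G g x)"

text \<open>
  The values of \<open>x\<close> outside the carrier of \<open>G\<close> do not occur in the matrix if \<open>g\<close> enumerates \<open>G\<close>,
  so letting \<open>x\<close> range over all functions amounts to choosing an integer for each group element.
\<close>

definition integer_group_dets :: "('g, 'm) monoid_scheme \<Rightarrow> (nat \<Rightarrow> 'g) \<Rightarrow> int set" where
  "integer_group_dets G g = range (group_det G g)"

end

theory Submission
  imports Defs
begin

text \<open>
  The regular representation of \<open>S\<^sub>4\<close> splits into the trivial character, the sign, two copies of the
  two-dimensional representation and three copies of each of the two three-dimensional ones, so the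
  group determinant is \<open>a b q\<^sup>2 (\<alpha> \<beta>)\<^sup>3\<close> with the determinants \<open>a\<close>, \<open>b\<close>, \<open>q\<close>, \<open>\<alpha>\<close>, \<open>\<beta>\<close> of \<open>\<Sum>x\<^sub>g \<rho>(g)\<close> in
  these representations. The splitting is made explicit over the integers by a basis of functions on
  \<open>S\<^sub>4\<close>, so that no field extension is needed.

  Write \<open>a = C + D\<close>, \<open>b = C - D\<close>, \<open>\<alpha> = E + O\<close>, \<open>\<beta> = E - O\<close>, where \<open>C\<close> and \<open>E\<close> are even under twisting \<open>x\<close>
  by the sign, and \<open>D\<close> and \<open>O\<close> are odd. The three-dimensional representations are monomial, and modulo 2
  they agree with the permutation representation of the quotient \<open>S\<^sub>3\<close>. Expanding one step further gives
  an integer \<open>f\<close> with \<open>E \<equiv> C q + 2 D f\<close> and \<open>O \<equiv> D q + 2 C f\<close> modulo 4. These two congruences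
  imply all the 2-adic restrictions on \<open>(C\<^sup>2 - D\<^sup>2) q\<^sup>2 (E\<^sup>2 - O\<^sup>2)\<^sup>3\<close>. The restriction at 3 follows
  from \<open>q \<equiv> a b\<close> modulo 3.

  Conversely, adding \<open>k\<close> to all \<open>x\<^sub>g\<close> changes \<open>a\<close> by \<open>24 k\<close> and leaves the other factors alone, so
  finitely many integer assignments produce all the required residue classes.
\<close>

section \<open>Congruences for the factors\<close>

definition det3 :: "(nat \<Rightarrow> int) \<Rightarrow> (nat \<Rightarrow> int) \<Rightarrow> (nat \<Rightarrow> int) \<Rightarrow> int" where
  "det3 a b c = a 1 * (b 2 * c 3 - b 3 * c 2) - a 2 * (b 1 * c 3 - b 3 * c 1)
     + a 3 * (b 1 * c 2 - b 2 * c 1)"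

text \<open>By multilinearity in the rows, every term of the expansion that contains at least two of
  the perturbations carries a factor 4.\<close>

lemma det3_diff_twice_cong:
  "[det3 (\<lambda>j. a j - 2 * x j) (\<lambda>j. b j - 2 * y j) (\<lambda>j. c j - 2 * z j)
      = det3 a b c - 2 * (det3 x b c + det3 a y c + det3 a b z)] (mod 4)"
  (is "[?l = ?r] (mod 4)")
proof -
  have "?l - ?r = 4 * (det3 x y c + det3 x b z + det3 a y z - 2 * det3 x y z)"
    unfolding det3_def by (simp add: algebra_simps)
  then show ?thesis
    unfolding cong_iff_dvd_diff by simp
qed

text \<open>
  For the Fourier coefficients \<open>F i s\<close> of \<open>x\<close> at the nontrivial character \<open>i\<close> of the Klein four-group, on the
  coset \<open>s\<close>, these are the rows of the rotation part (\<open>s = 0, 1, 2\<close>) and of the reflection part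
  (\<open>s = 3, 4, 5\<close>) of the image of \<open>x\<close> in a three-dimensional representation.
\<close>

definition mono_row :: "(nat \<Rightarrow> nat \<Rightarrow> int) \<Rightarrow> bool \<Rightarrow> nat \<Rightarrow> nat \<Rightarrow> int" where
  "mono_row F odd_part i j = F i (if odd_part then 3 + (2 * (i + j)) mod 3 else (i + 2 * j) mod 3)"

definition mono_det :: "int \<Rightarrow> (nat \<Rightarrow> nat \<Rightarrow> int) \<Rightarrow> int" where
  "mono_det \<epsilon> F = (let m = (\<lambda>i j. mono_row F False i j + \<epsilon> * mono_row F True i j)
     in det3 (m 1) (m 2) (m 3))"

text \<open>For a primitive cube root of unity w this is the norm of a + b w + c w^2. The value on
  the rotation cosets minus the value on the reflection cosets is the determinant in the
  two-dimensional representation.\<close>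

definition rot_form :: "int \<Rightarrow> int \<Rightarrow> int \<Rightarrow> int" where
  "rot_form a b c = a\<^sup>2 + b\<^sup>2 + c\<^sup>2 - a * b - b * c - c * a"

text \<open>
  The evenness hypothesis on \<open>u\<close> expresses that the four Fourier coefficients on a coset of the Klein
  four-group have a sum divisible by 4. Modulo 2 it removes from the terms \<open>ev L\<close> and \<open>od L\<close>, linear
  in \<open>u\<close>, everything except \<open>D * f\<close> and \<open>C * f\<close>.
\<close>

lemma mono_det_parts_cong:
  fixes c :: "nat \<Rightarrow> int" and u :: "nat \<Rightarrow> nat \<Rightarrow> int"
  assumes F: "\<And>i s. F i s = c s - 2 * u i s"
    and u: "\<And>s. even (u 1 s + u 2 s + u 3 s)"
    and C: "C = c 0 + c 1 + c 2" and D: "D = c 3 + c 4 + c 5"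
    and q: "q = rot_form (c 0) (c 1) (c 2) - rot_form (c 3) (c 4) (c 5)"
  obtains E O' f where "mono_det 1 F = E + O'" "mono_det (-1) F = E - O'"
    "[E = C * q + 2 * D * f] (mod 4)" "[O' = D * q + 2 * C * f] (mod 4)"
proof -
  define S where "S = (\<lambda>i::nat. c)"
  define M where "M = (\<lambda>G1 G2 G3 r s t. det3 (mono_row G1 r 1) (mono_row G2 s 2) (mono_row G3 t 3))"
  define L where "L = (\<lambda>r s t. M u S S r s t + M S u S r s t + M S S u r s t)"
  \<comment> \<open>\<open>ev\<close> and \<open>od\<close> collect the products with an even or odd
    number of reflection rows, so they become \<open>E\<close> and \<open>O'\<close>.\<close>
  define ev where "ev = (\<lambda>N :: bool \<Rightarrow> bool \<Rightarrow> bool \<Rightarrow> int.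
    N False False False + N False True True + N True False True + N True True False)"
  define od where "od = (\<lambda>N :: bool \<Rightarrow> bool \<Rightarrow> bool \<Rightarrow> int.
    N True True True + N True False False + N False True False + N False False True)"
  have "mono_row F t i = (\<lambda>j. mono_row S t i j - 2 * mono_row u t i j)" for t i
    by (simp add: mono_row_def F S_def fun_eq_iff)
  then have "[M F F F r s t = M S S S r s t - 2 * L r s t] (mod 4)" for r s t
    unfolding M_def L_def by (simp only: det3_diff_twice_cong)
  then have "[ev (M F F F) = ev (\<lambda>r s t. M S S S r s t - 2 * L r s t)] (mod 4)"
    "[od (M F F F) = od (\<lambda>r s t. M S S S r s t - 2 * L r s t)] (mod 4)"
    unfolding ev_def od_def by (intro cong_add; simp)+
  then have FS: "[ev (M F F F) = ev (M S S S) - 2 * ev L] (mod 4)"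
    "[od (M F F F) = od (M S S S) - 2 * od L] (mod 4)"
    unfolding ev_def od_def by (simp_all add: algebra_simps)
  define \<sigma> where "\<sigma> = (\<lambda>s. u 1 s + u 2 s + u 3 s)"
  define e where "e = (\<lambda>x y z :: int. x * y + y * z + z * x)"
  \<comment> \<open>Up to multiples of \<open>\<sigma> s\<close>, which are even,
    \<open>ev L\<close> is divisible by \<open>D\<close> and \<open>od L\<close> by
    \<open>C\<close>. The identities below show that both have the cofactor
    \<open>- f\<close>.\<close>
  define f where "f = c 4 * u 1 0 + c 5 * u 2 0 + c 3 * u 3 0 + c 3 * u 2 1 + c 4 * u 3 1 + c 5 * u 1 1
     + c 3 * u 1 2 + c 4 * u 2 2 + c 5 * u 3 2
     - (c 0 * u 1 4 + c 1 * u 2 3 + c 2 * u 3 5 + c 2 * u 1 3 + c 0 * u 2 5 + c 1 * u 3 4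
        + c 1 * u 1 5 + c 2 * u 2 4 + c 0 * u 3 3)"
  note defs = L_def M_def det3_def mono_row_def S_def \<sigma>_def f_def D e_def C ev_def od_def
     q rot_form_def power2_eq_square
  \<comment> \<open>The rows built from \<open>c\<close> alone give the permutation representation
    of the quotient group on three letters, which is trivial plus two-dimensional. Hence
    \<open>ev\<close> and \<open>od\<close> add up to (C + D) q, and the sign twist gives (C - D)
    q.\<close>
  have "ev (M S S S) = C * q" "od (M S S S) = D * q"
    unfolding defs by (simp_all add: algebra_simps numeral_2_eq_2)
  moreover have "ev L = - D * f + ((c 0 ^ 2 - c 1 * c 2 + e (c 3) (c 4) (c 5)) * \<sigma> 0
        + (c 1 ^ 2 - c 0 * c 2 + e (c 3) (c 4) (c 5)) * \<sigma> 1
        + (c 2 ^ 2 - c 0 * c 1 + e (c 3) (c 4) (c 5)) * \<sigma> 2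
        - C * (c 3 * \<sigma> 3 + c 4 * \<sigma> 4 + c 5 * \<sigma> 5))"
    unfolding defs by (simp add: algebra_simps numeral_2_eq_2)
  moreover have "od L = - C * f + (D * (c 0 * \<sigma> 0 + c 1 * \<sigma> 1 + c 2 * \<sigma> 2)
        - (c 3 ^ 2 - c 4 * c 5 + e (c 0) (c 1) (c 2)) * \<sigma> 3
        - (c 4 ^ 2 - c 3 * c 5 + e (c 0) (c 1) (c 2)) * \<sigma> 4
        - (c 5 ^ 2 - c 3 * c 4 + e (c 0) (c 1) (c 2)) * \<sigma> 5)"
    unfolding defs by (simp add: algebra_simps numeral_2_eq_2)
  moreover have "even (\<sigma> s)" for s
    using u by (simp add: \<sigma>_def)
  ultimately have "even (ev L + D * f)" "even (od L + C * f)"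
    and S: "ev (M S S S) = C * q" "od (M S S S) = D * q"
    by simp_all
  moreover have "[k - 2 * x = k + 2 * y * f] (mod 4)" if xy: "even (x + y * f)" for k x y
  proof -
    obtain t where "x + y * f = 2 * t" using xy by (rule evenE)
    then have "(k + 2 * y * f) - (k - 2 * x) = 4 * t" by (simp add: algebra_simps)
    then show ?thesis by (metis cong_iff_dvd_diff cong_sym dvd_triv_left)
  qed
  ultimately have "[ev (M S S S) - 2 * ev L = C * q + 2 * D * f] (mod 4)"
    "[od (M S S S) - 2 * od L = D * q + 2 * C * f] (mod 4)"
    by simp_all
  with FS have "[ev (M F F F) = C * q + 2 * D * f] (mod 4)" "[od (M F F F) = D * q + 2 * C * f] (mod 4)"
    by (blast intro: cong_trans)+
  moreover have "mono_det 1 F = ev (M F F F) + od (M F F F)"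
    "mono_det (-1) F = ev (M F F F) - od (M F F F)"
    unfolding mono_det_def Let_def ev_def od_def M_def det3_def
    by (simp_all add: algebra_simps)
  ultimately show ?thesis
    using that by blast
qed

section \<open>The prime powers in the product\<close>

lemma diff_squares_same_parity:
  fixes a b :: int
  assumes "even (a + b)"
  shows "4 dvd a\<^sup>2 - b\<^sup>2"
proof -
  have "2 * 2 dvd (a - b) * (a + b)"
    using assms by (intro mult_dvd_mono) auto
  then show ?thesis
    by (simp add: power2_eq_square square_diff_square_factored mult.commute)
qed

lemma diff_squares_odd: "odd a \<Longrightarrow> odd b \<Longrightarrow> 8 dvd a\<^sup>2 - b\<^sup>2" for a b :: int
proof -
  have "\<exists>k. a\<^sup>2 = 8 * k + 1" if odd: "odd a" for a :: int
  proof -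
    obtain m where m: "a = 2 * m + 1" using odd by (rule oddE)
    have "even (m * (m + 1))" by simp
    then obtain k where "m * (m + 1) = 2 * k" ..
    then have "a\<^sup>2 = 8 * k + 1" unfolding m by (simp add: power2_eq_square algebra_simps)
    then show ?thesis ..
  qed
  moreover assume "odd a" "odd b"
  ultimately obtain k l where "a\<^sup>2 = 8 * k + 1" "b\<^sup>2 = 8 * l + 1" by blast
  then have "a\<^sup>2 - b\<^sup>2 = 8 * (k - l)" by simp
  then show ?thesis by simp
qed

lemma square_mod_4: "a\<^sup>2 mod 4 = (if even a then 0 else 1)" for a :: int
proof (cases "even a")
  case True
  then obtain k where "a = 2 * k" ..
  then show ?thesis by (simp add: power2_eq_square)
next
  case False
  then obtain k where "a = 2 * k + 1" by (elim oddE)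
  then have "a\<^sup>2 = 4 * (k\<^sup>2 + k) + 1" by (simp add: power2_eq_square algebra_simps)
  then show ?thesis using False by presburger
qed

lemma diff_squares_mod_4: "(a\<^sup>2 - b\<^sup>2) mod 4 = (if even (a + b) then 0 else if odd a then 1 else 3)"
  for a b :: int
proof -
  have "(a\<^sup>2 - b\<^sup>2) mod 4 = (a\<^sup>2 mod 4 - b\<^sup>2 mod 4) mod 4" by (simp add: mod_simps)
  then show ?thesis unfolding square_mod_4 by auto
qed

lemma mod_mult_power_3: "(x * y * z ^ 3) mod k = ((x mod k) * (y mod k) * (z mod k) ^ 3) mod k"
  for x y z k :: int
  by (metis mod_mult_eq power_mod)

text \<open>\<open>E\<close> and \<open>O'\<close> have the parities of \<open>C\<close> and
  \<open>D\<close>, so both differences of squares are the same unit modulo 4. Their total exponent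
  1 + 3 is even.\<close>

lemma odd_det_mod_4:
  fixes C D q E O' :: int
  assumes "odd (C + D)" "odd q" "even (E + C)" "even (O' + D)"
  shows "((C\<^sup>2 - D\<^sup>2) * q\<^sup>2 * (E\<^sup>2 - O'\<^sup>2) ^ 3) mod 4 = 1"
proof -
  have "((C\<^sup>2 - D\<^sup>2) * q\<^sup>2 * (E\<^sup>2 - O'\<^sup>2) ^ 3) mod 4
      = (((C\<^sup>2 - D\<^sup>2) mod 4) * (q\<^sup>2 mod 4) * ((E\<^sup>2 - O'\<^sup>2) mod 4) ^ 3) mod 4"
    by (rule mod_mult_power_3)
  moreover have "odd (E + O')" "odd E \<longleftrightarrow> odd C"
    using assms by auto
  ultimately show ?thesis
    unfolding diff_squares_mod_4 square_mod_4 using assms by auto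
qed

text \<open>The congruences pass factors 2 of \<open>C\<close>, \<open>D\<close>, \<open>q\<close>
  on to \<open>E\<close> and \<open>O'\<close>, whose difference of squares enters cubed. If just 4
  is split off from it, another 4 comes from C^2 - D^2 or from q^2, which makes 2^8; the remaining
  cofactor is then \<open>odd_det_mod_4\<close> again, or yields further factors 2.\<close>

lemma det_power_2_part:
  fixes C D q E O' f :: int
  assumes E: "[E = C * q + 2 * D * f] (mod 4)" and O': "[O' = D * q + 2 * C * f] (mod 4)"
    and T: "T = (C\<^sup>2 - D\<^sup>2) * q\<^sup>2 * (E\<^sup>2 - O'\<^sup>2) ^ 3"
  shows "T mod 4 = 1 \<or> (\<exists>m. T = 2 ^ 8 * m \<and> m mod 4 = 1) \<or> (\<exists>m. T = 2 ^ 10 * m \<and> m mod 4 = 3) \<or> 2 ^ 12 dvd T"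
proof -
  obtain m where E: "E = C * q + 2 * D * f + 4 * m"
    using E by (metis cong_iff_lin cong_sym)
  obtain n where O': "O' = D * q + 2 * C * f + 4 * n"
    using O' by (metis cong_iff_lin cong_sym)
  consider (1) "odd (C + D)" "odd q" | (2) "odd C" "odd D" "odd q" | (3) "even C" "even D" "odd q"
    | (4) "odd (C + D)" "even q" | (5) "even C" "even D" "even q" | (6) "odd C" "odd D" "even q"
    by fastforce
  then show ?thesis
  proof cases
    case 1
    then show ?thesis using odd_det_mod_4[of C D q E O'] E O' T by simp
  next
    case 2
    then have "odd E" "odd O'" by (simp_all add: E O')
    with 2 obtain x y where "C\<^sup>2 - D\<^sup>2 = 8 * x" "E\<^sup>2 - O'\<^sup>2 = 8 * y"
      using diff_squares_odd by (meson dvdE)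
    then have "T = 2 ^ 12 * (x * q\<^sup>2 * y ^ 3)" unfolding T by (simp add: power_mult_distrib)
    then show ?thesis by simp
  next
    case 3
    then obtain c d where c: "C = 2 * c" and d: "D = 2 * d" by (elim evenE)
    define e o' where "e = c * q + 2 * d * f + 2 * m" and "o' = d * q + 2 * c * f + 2 * n"
    have eo: "E = 2 * e" "O' = 2 * o'" by (simp_all add: e_def o'_def E O' c d)
    have T': "T = 2 ^ 8 * ((c\<^sup>2 - d\<^sup>2) * q\<^sup>2 * (e\<^sup>2 - o'\<^sup>2) ^ 3)"
    proof -
      have "C\<^sup>2 - D\<^sup>2 = 4 * (c\<^sup>2 - d\<^sup>2)" "E\<^sup>2 - O'\<^sup>2 = 4 * (e\<^sup>2 - o'\<^sup>2)"
        by (simp_all add: c d eo power_mult_distrib)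
      then show ?thesis unfolding T by (simp only: power_mult_distrib) simp
    qed
    have par: "even (e + c)" "even (o' + d)" using 3 by (simp_all add: e_def o'_def)
    show ?thesis
    proof (cases "even (c + d)")
      case True
      with par have "even (e + o')" by auto
      with True obtain x y where "c\<^sup>2 - d\<^sup>2 = 4 * x" "e\<^sup>2 - o'\<^sup>2 = 4 * y"
        using diff_squares_same_parity by (meson dvdE)
      then have "T = 2 ^ 12 * (16 * (x * q\<^sup>2 * y ^ 3))" unfolding T' by (simp add: power_mult_distrib)
      then show ?thesis by (metis dvd_triv_left)
    next
      case False
      then show ?thesis using odd_det_mod_4[of c d q e o'] par 3 T' by blast
    qed
  next
    case 4
    then obtain r where r: "q = 2 * r" by (elim evenE)
    define e o' where "e = C * r + D * f + 2 * m" and "o' = D * r + C * f + 2 * n"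
    have eo: "E = 2 * e" "O' = 2 * o'" by (simp_all add: e_def o'_def E O' r)
    have T': "T = 2 ^ 8 * ((C\<^sup>2 - D\<^sup>2) * r\<^sup>2 * (e\<^sup>2 - o'\<^sup>2) ^ 3)"
    proof -
      have "E\<^sup>2 - O'\<^sup>2 = 4 * (e\<^sup>2 - o'\<^sup>2)"
        by (simp add: eo power_mult_distrib)
      then show ?thesis unfolding T r by (simp only: power_mult_distrib) simp
    qed
    show ?thesis
    proof (cases "even r")
      case False
      show ?thesis
      proof (cases "even f")
        case True
        then have "even (e + C)" "even (o' + D)" using False by (simp_all add: e_def o'_def)
        then show ?thesis using odd_det_mod_4[of C D r e o'] 4 False T' by blast
      next
        case f: False
        then have "odd e" "odd o'" using False 4 by (auto simp: e_def o'_def)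
        then obtain y where "e\<^sup>2 - o'\<^sup>2 = 8 * y" using diff_squares_odd by (meson dvdE)
        then have "T = 2 ^ 12 * (32 * ((C\<^sup>2 - D\<^sup>2) * r\<^sup>2 * y ^ 3))"
          unfolding T' by (simp add: power_mult_distrib)
        then show ?thesis by (metis dvd_triv_left)
      qed
    next
      case True
      then obtain s where s: "r = 2 * s" ..
      have T'': "T = 2 ^ 10 * ((C\<^sup>2 - D\<^sup>2) * s\<^sup>2 * (e\<^sup>2 - o'\<^sup>2) ^ 3)"
        unfolding T' by (simp add: s power_mult_distrib)
      show ?thesis
      proof (cases "even f")
        case f: True
        then have "even (e + o')" by (simp add: e_def o'_def s)
        then obtain y where "e\<^sup>2 - o'\<^sup>2 = 4 * y" using diff_squares_same_parity by (meson dvdE)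
        then have "T = 2 ^ 12 * (16 * ((C\<^sup>2 - D\<^sup>2) * s\<^sup>2 * y ^ 3))"
          unfolding T'' by (simp add: power_mult_distrib)
        then show ?thesis by (metis dvd_triv_left)
      next
        case f: False
        show ?thesis
        proof (cases "even s")
          case True
          then obtain t where "s = 2 * t" ..
          then have "T = 2 ^ 12 * ((C\<^sup>2 - D\<^sup>2) * t\<^sup>2 * (e\<^sup>2 - o'\<^sup>2) ^ 3)"
            unfolding T'' by (simp add: power_mult_distrib)
          then show ?thesis by (metis dvd_triv_left)
        next
          case False
          have "((C\<^sup>2 - D\<^sup>2) * s\<^sup>2 * (e\<^sup>2 - o'\<^sup>2) ^ 3) mod 4
              = (((C\<^sup>2 - D\<^sup>2) mod 4) * (s\<^sup>2 mod 4) * ((e\<^sup>2 - o'\<^sup>2) mod 4) ^ 3) mod 4"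
            by (rule mod_mult_power_3)
          \<comment> \<open>Here \<open>r\<close> is even and \<open>f\<close> is odd, so the
            parities of \<open>C\<close> and \<open>D\<close> are swapped: e^2 - o'^2 is minus C^2 -
            D^2 modulo 4, and the cube keeps this sign. This is the source of the residue 3.\<close>
          moreover have "odd e \<longleftrightarrow> odd D" "odd o' \<longleftrightarrow> odd C"
            using f by (simp_all add: e_def o'_def s)
          ultimately have "((C\<^sup>2 - D\<^sup>2) * s\<^sup>2 * (e\<^sup>2 - o'\<^sup>2) ^ 3) mod 4 = 3"
            unfolding diff_squares_mod_4 square_mod_4 using False 4 by auto
          then show ?thesis using T'' by blast
        qed
      qed
    qed
  next
    case 5
    then obtain c d r where "C = 2 * c" "D = 2 * d" "q = 2 * r" by (elim evenE)
    then have "E = 4 * (c * r + d * f + m)" "O' = 4 * (d * r + c * f + n)"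
      by (simp_all add: E O')
    then obtain e o' where "E = 4 * e" "O' = 4 * o'" by blast
    then have "E\<^sup>2 - O'\<^sup>2 = 16 * (e\<^sup>2 - o'\<^sup>2)" by (simp add: power_mult_distrib)
    then have "T = 2 ^ 12 * ((C\<^sup>2 - D\<^sup>2) * q\<^sup>2 * (e\<^sup>2 - o'\<^sup>2) ^ 3)"
      unfolding T by (simp only: power_mult_distrib) simp
    then show ?thesis by (metis dvd_triv_left)
  next
    case 6
    then obtain r where r: "q = 2 * r" by (elim evenE)
    define e o' where "e = C * r + D * f + 2 * m" and "o' = D * r + C * f + 2 * n"
    have eo: "E = 2 * e" "O' = 2 * o'" by (simp_all add: e_def o'_def E O' r)
    have "even (e + o')" using 6 by (simp add: e_def o'_def)
    then obtain y where "e\<^sup>2 - o'\<^sup>2 = 4 * y" using diff_squares_same_parity by (meson dvdE)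
    then have "E\<^sup>2 - O'\<^sup>2 = 16 * y" by (simp add: eo power_mult_distrib)
    then have "T = 2 ^ 12 * ((C\<^sup>2 - D\<^sup>2) * q\<^sup>2 * y ^ 3)"
      unfolding T by (simp add: power_mult_distrib)
    then show ?thesis by (metis dvd_triv_left)
  qed
qed

text \<open>C^2 - D^2 and \<open>q\<close> agree modulo 3. So 3 divides both, giving 3 * 3^2, or it
  divides \<open>w\<close>, which is cubed.\<close>

lemma det_power_3_part:
  fixes C D q E O' :: int
  assumes q: "q = rot_form c0 c1 c2 - rot_form d0 d1 d2" and C: "C = c0 + c1 + c2" and D: "D = d0 + d1 + d2"
    and "3 dvd (C\<^sup>2 - D\<^sup>2) * q\<^sup>2 * w ^ 3"
  shows "3 ^ 3 dvd (C\<^sup>2 - D\<^sup>2) * q\<^sup>2 * w ^ 3"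
proof -
  have p: "prime (3 :: int)" by simp
  have "(C\<^sup>2 - D\<^sup>2) - q = 3 * (c0 * c1 + c1 * c2 + c2 * c0 - (d0 * d1 + d1 * d2 + d2 * d0))"
    unfolding q C D rot_form_def by (simp add: algebra_simps power2_eq_square)
  then have "3 dvd (C\<^sup>2 - D\<^sup>2) - q" by simp
  then have "3 dvd C\<^sup>2 - D\<^sup>2 \<longleftrightarrow> 3 dvd q" by presburger
  moreover have "3 dvd C\<^sup>2 - D\<^sup>2 \<or> 3 dvd q \<or> 3 dvd w"
    using assms(4) p by (metis prime_dvd_mult_iff prime_dvd_power)
  ultimately consider "3 dvd C\<^sup>2 - D\<^sup>2" "3 dvd q" | "3 dvd w" by blast
  then show ?thesis
  proof cases
    case 1
    then have "3 * 3 ^ 2 dvd (C\<^sup>2 - D\<^sup>2) * q\<^sup>2" by (intro mult_dvd_mono dvd_power_same)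
    then show ?thesis by simp
  next
    case 2
    then show ?thesis by (intro dvd_mult dvd_power_same)
  qed
qed

section \<open>Determinants of matrices with blocks\<close>

lemma det_mat_block_diag:
  fixes f :: "nat \<Rightarrow> nat \<Rightarrow> 'a :: idom"
  assumes "\<And>i j. i < k \<Longrightarrow> j < n \<Longrightarrow> f i (k + j) = 0" "\<And>i j. i < k \<Longrightarrow> j < n \<Longrightarrow> f (k + j) i = 0"
  shows "det (mat (k + n) (k + n) (\<lambda>(i, j). f i j))
    = det (mat k k (\<lambda>(i, j). f i j)) * det (mat n n (\<lambda>(i, j). f (k + i) (k + j)))"
proof -
  have "mat (k + n) (k + n) (\<lambda>(i, j). f i j)
      = four_block_mat (mat k k (\<lambda>(i, j). f i j)) (0\<^sub>m k n) (0\<^sub>m n k) (mat n n (\<lambda>(i, j). f (k + i) (k + j)))"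
    (is "?l = ?r")
  proof (rule eq_matI)
    fix i j assume "i < dim_row ?r" "j < dim_col ?r"
    then have ij: "i < k + n" "j < k + n" by auto
    show "?l $$ (i, j) = ?r $$ (i, j)"
      using ij assms(1)[of i "j - k"] assms(2)[of j "i - k"]
      by (cases "i < k"; cases "j < k") (auto)
  qed auto
  then show ?thesis
    by (simp only: det_four_block_mat_upper_right_zero[OF mat_carrier refl zero_carrier_mat mat_carrier])
qed

lemma det_mat_1: "det (mat 1 1 f) = f (0, 0)"
  by (subst det_single) auto

lemma det_mat_2: "det (mat 2 2 f) = f (0, 0) * f (1, 1) - f (0, 1) * f (1, 0)"
  by (subst laplace_expansion_row[of _ 2 0])
     (auto simp: cofactor_def numeral_2_eq_2 det_single mat_delete_def)

lemma det_mat_3: "det (mat 3 3 f) = f (0, 0) * (f (1, 1) * f (2, 2) - f (1, 2) * f (2, 1))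
    - f (0, 1) * (f (1, 0) * f (2, 2) - f (1, 2) * f (2, 0))
    + f (0, 2) * (f (1, 0) * f (2, 1) - f (1, 1) * f (2, 0))"
  by (subst laplace_expansion_row[of _ 3 0])
     (auto simp: cofactor_def mat_delete_def numeral_3_eq_3 numeral_2_eq_2
       det_mat_2[unfolded numeral_2_eq_2] algebra_simps)

section \<open>Elements and representations of the symmetric group\<close>

definition S4_translation :: "nat \<Rightarrow> nat \<Rightarrow> nat" where
  "S4_translation v = (if v = 1 then transpose 1 4 \<circ> transpose 2 3
     else if v = 2 then transpose 2 4 \<circ> transpose 1 3
     else if v = 3 then transpose 3 4 \<circ> transpose 1 2 else id)"

text \<open>The stabiliser of the point 4, a complement of the Klein four-group. This numbering
  produces the coset indices in \<open>mono_row\<close>.\<close>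

definition S3_elem :: "nat \<Rightarrow> nat \<Rightarrow> nat" where
  "S3_elem s = (if s = 1 then transpose 1 2 \<circ> transpose 2 3
     else if s = 2 then transpose 2 3 \<circ> transpose 1 2
     else if s = 3 then transpose 1 2 else if s = 4 then transpose 2 3
     else if s = 5 then transpose 1 3 else id)"

text \<open>
  The elements \<open>4 * s, \<dots>, 4 * s + 3\<close> form the coset \<open>s\<close> of the Klein four-group. The cosets 0, 1, 2 are
  the even ones.
\<close>

definition S4_elem :: "nat \<Rightarrow> nat \<Rightarrow> nat" where
  "S4_elem n = S4_translation (n mod 4) \<circ> S3_elem (n div 4)"

abbreviation S4 :: "(nat \<Rightarrow> nat) set" where
  "S4 \<equiv> {p. p permutes {1..4}}"

lemma S4_elem_permutes: "S4_elem n permutes {1..4}"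
  unfolding S4_elem_def S4_translation_def S3_elem_def
  by (auto intro!: permutes_compose permutes_swap_id permutes_id)

lemma upt_24: "[0..<24] = [0, 1, 2, 3, 4, 5, 6, 7, 8, 9, 10, 11, 12, 13, 14, 15, 16, 17, 18, 19, 20, 21, 22, 23]"
  by (simp add: upt_rec)

lemma less_24_iff: "(n :: nat) < 24 \<longleftrightarrow> n \<in> set [0, 1, 2, 3, 4, 5, 6, 7, 8, 9, 10, 11, 12, 13, 14, 15, 16, 17, 18, 19, 20, 21, 22, 23]"
  unfolding upt_24[symmetric] by simp

lemma sign_S4_elem:
  assumes "n < 24"
  shows "sign (S4_elem n) = (if n < 12 then 1 else -1)"
  using assms unfolding less_24_iff
  by (auto simp: S4_elem_def S4_translation_def S3_elem_def sign_compose permutation_compose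
      permutation_swap_id sign_swap_id)

lemma S4_elem_map:
  shows "map (S4_elem 0) [1, 2, 3, 4] = [1, 2, 3, 4]"
  "map (S4_elem 1) [1, 2, 3, 4] = [4, 3, 2, 1]"
  "map (S4_elem 2) [1, 2, 3, 4] = [3, 4, 1, 2]"
  "map (S4_elem 3) [1, 2, 3, 4] = [2, 1, 4, 3]"
  "map (S4_elem 4) [1, 2, 3, 4] = [2, 3, 1, 4]"
  "map (S4_elem 5) [1, 2, 3, 4] = [3, 2, 4, 1]"
  "map (S4_elem 6) [1, 2, 3, 4] = [4, 1, 3, 2]"
  "map (S4_elem 7) [1, 2, 3, 4] = [1, 4, 2, 3]"
  "map (S4_elem 8) [1, 2, 3, 4] = [3, 1, 2, 4]"
  "map (S4_elem 9) [1, 2, 3, 4] = [2, 4, 3, 1]"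
  "map (S4_elem 10) [1, 2, 3, 4] = [1, 3, 4, 2]"
  "map (S4_elem 11) [1, 2, 3, 4] = [4, 2, 1, 3]"
  "map (S4_elem 12) [1, 2, 3, 4] = [2, 1, 3, 4]"
  "map (S4_elem 13) [1, 2, 3, 4] = [3, 4, 2, 1]"
  "map (S4_elem 14) [1, 2, 3, 4] = [4, 3, 1, 2]"
  "map (S4_elem 15) [1, 2, 3, 4] = [1, 2, 4, 3]"
  "map (S4_elem 16) [1, 2, 3, 4] = [1, 3, 2, 4]"
  "map (S4_elem 17) [1, 2, 3, 4] = [4, 2, 3, 1]"
  "map (S4_elem 18) [1, 2, 3, 4] = [3, 1, 4, 2]"
  "map (S4_elem 19) [1, 2, 3, 4] = [2, 4, 1, 3]"
  "map (S4_elem 20) [1, 2, 3, 4] = [3, 2, 1, 4]"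
  "map (S4_elem 21) [1, 2, 3, 4] = [2, 3, 4, 1]"
  "map (S4_elem 22) [1, 2, 3, 4] = [1, 4, 3, 2]"
  "map (S4_elem 23) [1, 2, 3, 4] = [4, 1, 2, 3]"
  by (simp_all add: S4_elem_def S4_translation_def S3_elem_def transpose_def)

lemmas S4_elem_eval = S4_elem_map[simplified]

lemma sum_less_24:
  "(\<Sum>n<24. f n) = f 0 + f 1 + f 2 + f 3 + f 4 + f 5 + f 6 + f 7 + f 8 + f 9 + f 10 + f 11 + f 12
    + f 13 + f 14 + f 15 + f 16 + f 17 + f 18 + f 19 + f 20 + f 21 + f 22 + f (23 :: nat)"
  for f :: "nat \<Rightarrow> 'a :: comm_monoid_add"
  by (simp add: eval_nat_numeral)

lemma bij_betw_S4_elem: "bij_betw S4_elem {..<24} S4"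
proof -
  have inj: "inj_on S4_elem {..<24}"
  \<comment> \<open>Comparing only the images of 1, 2, 3 turns injectivity into distinctness of 24
    explicit lists.\<close>
  proof (rule inj_on_imageI2[of "\<lambda>p. [p 1, p 2, p 3]"])
    have "distinct (map ((\<lambda>p. [p 1, p 2, p 3]) \<circ> S4_elem) [0..<24])"
      unfolding upt_24 by (simp add: S4_elem_eval)
    then show "inj_on ((\<lambda>p. [p 1, p 2, p 3]) \<circ> S4_elem) {..<24}"
      unfolding distinct_map by (simp add: lessThan_atLeast0)
  qed
  moreover have "card S4 = 24"
    by (simp add: card_permutations fact_numeral)
  then have "S4_elem ` {..<24} = S4"
    using inj S4_elem_permutes
    by (intro card_subset_eq) (auto simp: card_image finite_permutations)
  ultimately show ?thesis
    by (simp add: bij_betw_def)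
qed

text \<open>
  The points \<open>1, \<dots>, 4\<close> are identified with the Klein four-group, with 4 as its zero. Then
  \<open>chr l i\<close> is the value of its \<open>i\<close>-th nontrivial character at \<open>l\<close>, and permuting the points permutes the
  functions \<open>\<plusminus>chr _ i\<close>.
\<close>

definition chr :: "nat \<Rightarrow> nat \<Rightarrow> int" where
  "chr l i = (if l = i \<or> l = 4 then 1 else -1)"

text \<open>The coefficient is the mean of \<open>chr m j * chr (u m) i\<close> over the four
  points. As the characters sum to 0 and \<open>chr m j\<close> is 1 only at \<open>j\<close> and 4,
  it equals half of \<open>chr (u j) i + chr (u 4) i\<close>.\<close>

definition std_rep :: "(nat \<Rightarrow> nat) \<Rightarrow> nat \<Rightarrow> nat \<Rightarrow> int" where
  "std_rep u i j = (if chr (u j) i = chr (u 4) i then chr (u 4) i else 0)"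

text \<open>
  \<open>chr l i * chr m i\<close> depends for \<open>l \<noteq> m\<close> only on the partition of the four points into two pairs given by
  \<open>{l, m}\<close>, so the following functions span the two-dimensional representation.
\<close>

definition pair_chr :: "nat \<Rightarrow> nat \<Rightarrow> nat \<Rightarrow> int" where
  "pair_chr i l m = chr l i * chr m i - chr l 3 * chr m 3"

text \<open>Squaring removes the signs of the monomial matrix, since the products
  \<open>chr l i * chr m i\<close> are permuted without signs. The subtraction expresses this
  permutation on differences with the third product.\<close>

definition plane_rep :: "(nat \<Rightarrow> nat) \<Rightarrow> nat \<Rightarrow> nat \<Rightarrow> int" where
  "plane_rep u i j = (std_rep u i j)\<^sup>2 - (std_rep u i 3)\<^sup>2"

lemma S4_elem_exhaust:
  assumes "u \<in> S4" "\<forall>n\<in>set [0, 1, 2, 3, 4, 5, 6, 7, 8, 9, 10, 11, 12, 13, 14, 15, 16, 17, 18, 19, 20, 21, 22, 23]. P (S4_elem n)"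
  shows "P u"
proof -
  obtain n where "n < 24" "u = S4_elem n"
    using assms(1) bij_betw_S4_elem unfolding bij_betw_def by blast
  then show ?thesis using assms(2) unfolding less_24_iff by blast
qed

lemma chr_std_rep:
  assumes "u \<in> S4"
  shows "\<forall>m\<in>{1, 2, 3, 4}. \<forall>j\<in>{1, 2, 3}. chr m j
      = chr (u m) 1 * std_rep u 1 j + chr (u m) 2 * std_rep u 2 j + chr (u m) 3 * std_rep u 3 j"
  by (rule S4_elem_exhaust[OF assms], simp only: list.set ball_simps, intro conjI TrueI)
     (simp_all add: std_rep_def S4_elem_eval chr_def)

lemma pair_chr_plane_rep:
  assumes "u \<in> S4"
  shows "\<forall>l\<in>{1, 2, 3, 4}. \<forall>m\<in>{1, 2, 3, 4}. l \<noteq> m \<longrightarrow> (\<forall>j\<in>{1, 2}. pair_chr j l m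
      = pair_chr 1 (u l) (u m) * plane_rep u 1 j + pair_chr 2 (u l) (u m) * plane_rep u 2 j)"
  by (rule S4_elem_exhaust[OF assms], simp only: list.set ball_simps, intro conjI TrueI)
     (simp_all add: plane_rep_def pair_chr_def std_rep_def S4_elem_eval chr_def)

section \<open>Block diagonalisation of the group matrix\<close>

text \<open>
  A basis of the functions on the group in which translations act by blocks of sizes
  1, 1, 2, 2 and six times 3. \<open>S4_dual_fun\<close> is its dual basis up to scalars.
\<close>

definition S4_fun :: "nat \<Rightarrow> (nat \<Rightarrow> nat) \<Rightarrow> int" where
  "S4_fun c h = (if c = 0 then 1 else if c = 1 then sign h
     else if c < 6 then pair_chr (c mod 2 + 1) (h (c div 2)) (h 4)
     else if c < 15 then chr (h (c div 3 - 1)) (c mod 3 + 1)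
     else sign h * chr (h (c div 3 - 4)) (c mod 3 + 1))"

definition S4_dual_fun :: "nat \<Rightarrow> (nat \<Rightarrow> nat) \<Rightarrow> int" where
  "S4_dual_fun c h = (if c = 0 then 1 else if c = 1 then sign h
     else if c < 6 then (chr (h (c div 2)) (c mod 2 + 1) - chr (h 3) (c mod 2 + 1)) * chr (h 4) (c mod 2 + 1)
     else if c < 15 then chr (h (c div 3 - 1)) (c mod 3 + 1) - chr (h 4) (c mod 3 + 1)
     else sign h * (chr (h (c div 3 - 4)) (c mod 3 + 1) - chr (h 4) (c mod 3 + 1)))"

definition S4_block :: "nat \<Rightarrow> nat" where
  "S4_block c = (if c < 2 then c else if c < 6 then c div 2 + 1 else c div 3 + 2)"

definition S4_coeff :: "(nat \<Rightarrow> nat) \<Rightarrow> nat \<Rightarrow> nat \<Rightarrow> int" where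
  "S4_coeff u r c = (if S4_block r \<noteq> S4_block c then 0 else if c = 0 then 1 else if c = 1 then sign u
     else if c < 6 then plane_rep u (r mod 2 + 1) (c mod 2 + 1)
     else if c < 15 then std_rep u (r mod 3 + 1) (c mod 3 + 1)
     else sign u * std_rep u (r mod 3 + 1) (c mod 3 + 1))"

lemmas S4_fun_eval =
  S4_fun_def[of 0] S4_fun_def[of 1] S4_fun_def[of 2] S4_fun_def[of 3] S4_fun_def[of 4]
  S4_fun_def[of 5] S4_fun_def[of 6] S4_fun_def[of 7] S4_fun_def[of 8] S4_fun_def[of 9]
  S4_fun_def[of 10] S4_fun_def[of 11] S4_fun_def[of 12] S4_fun_def[of 13] S4_fun_def[of 14]
  S4_fun_def[of 15] S4_fun_def[of 16] S4_fun_def[of 17] S4_fun_def[of 18] S4_fun_def[of 19]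
  S4_fun_def[of 20] S4_fun_def[of 21] S4_fun_def[of 22] S4_fun_def[of 23]

lemmas S4_fun_simps = S4_fun_eval[simplified]

lemmas S4_dual_fun_eval =
  S4_dual_fun_def[of 0] S4_dual_fun_def[of 1] S4_dual_fun_def[of 2] S4_dual_fun_def[of 3] S4_dual_fun_def[of 4]
  S4_dual_fun_def[of 5] S4_dual_fun_def[of 6] S4_dual_fun_def[of 7] S4_dual_fun_def[of 8] S4_dual_fun_def[of 9]
  S4_dual_fun_def[of 10] S4_dual_fun_def[of 11] S4_dual_fun_def[of 12] S4_dual_fun_def[of 13] S4_dual_fun_def[of 14]
  S4_dual_fun_def[of 15] S4_dual_fun_def[of 16] S4_dual_fun_def[of 17] S4_dual_fun_def[of 18] S4_dual_fun_def[of 19]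
  S4_dual_fun_def[of 20] S4_dual_fun_def[of 21] S4_dual_fun_def[of 22] S4_dual_fun_def[of 23]

lemmas S4_dual_fun_simps = S4_dual_fun_eval[simplified]

text \<open>A basis function sees \<open>h\<close> only through its sign and the points
  \<open>h k\<close>, so left translation acts through \<open>chr_std_rep\<close> and
  \<open>pair_chr_plane_rep\<close>, with a matrix that does not depend on \<open>k\<close>.\<close>

lemma S4_fun_translate:
  assumes u: "u \<in> S4" and h: "h \<in> S4" and c: "c < 24"
  shows "S4_fun c (inv' u \<circ> h) = (\<Sum>r<24. S4_fun r h * S4_coeff u r c)"
proof -
  have up: "u permutes {1..4}" and hp: "h permutes {1..4}" using u h by auto
  have S: "{1..4} = {1, 2, 3, 4 :: nat}" by auto
  have v: "inv' u (h k) \<in> {1, 2, 3, 4}" if "k \<in> {1, 2, 3, 4}" for k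
    using that permutes_in_image[OF hp, of k] permutes_in_image[OF permutes_inv[OF up], of "h k"]
    unfolding S by blast
  have ne: "inv' u (h k) \<noteq> inv' u (h 4)" if "k \<in> {1, 2}" for k
    using that inj_eq[OF permutes_inj[OF permutes_inv[OF up]]] inj_eq[OF permutes_inj[OF hp]] by auto
  have uv: "u (inv' u l) = l" for l using up by (simp add: permutes_inverses)
  have 1: "chr (inv' u (h k)) j = chr (h k) 1 * std_rep u 1 j + chr (h k) 2 * std_rep u 2 j + chr (h k) 3 * std_rep u 3 j"
    if "k \<in> {1, 2, 3, 4}" "j \<in> {1, 2, 3}" for k j
    using chr_std_rep[OF u, rule_format, OF v[OF that(1)] that(2)] by (simp add: uv)
  have 2: "pair_chr j (inv' u (h k)) (inv' u (h 4)) = pair_chr 1 (h k) (h 4) * plane_rep u 1 j + pair_chr 2 (h k) (h 4) * plane_rep u 2 j"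
    if "k \<in> {1, 2}" "j \<in> {1, 2}" for k j
  proof -
    have "k \<in> {1, 2, 3, 4}" using that(1) by auto
    from pair_chr_plane_rep[OF u, rule_format, OF v[OF this] v[of 4] ne[OF that(1)] that(2)] show ?thesis
      by (simp add: uv)
  qed
  have 3: "sign (inv' u \<circ> h) = sign u * sign h"
    using permutes_imp_permutation[OF _ up] permutes_imp_permutation[OF _ hp]
    by (simp add: sign_compose sign_inverse permutation_inverse)
  have "\<forall>c\<in>set [0..<24]. S4_fun c (inv' u \<circ> h) = (\<Sum>r<24. S4_fun r h * S4_coeff u r c)"
    unfolding upt_24 sum_less_24
    by (simp only: list.set ball_simps, intro conjI TrueI)
       (simp_all add: S4_fun_simps S4_coeff_def S4_block_def 1 2 3 distrib_left mult.assoc mult.left_commute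
         flip: numeral_2_eq_2)
  then show ?thesis using c by simp
qed

text \<open>By symmetry, the subtracted value at the reference point (4, or 3 for the pair
  functions) has the same pairing with a different point as the first term, so the two
  cancel.\<close>

lemma S4_dual_fun_orthogonal:
  assumes "r < 24" "c < 24"
  shows "(\<Sum>n<24. S4_dual_fun r (S4_elem n) * S4_fun c (S4_elem n))
    = (if r = c then (if r < 2 then 24 else if r < 6 then 48 else 32) else 0)"
proof -
  have "\<forall>r\<in>set [0..<24]. \<forall>c\<in>set [0..<24]. (\<Sum>n<24. S4_dual_fun r (S4_elem n) * S4_fun c (S4_elem n))
    = (if r = c then (if r < 2 then 24 else if r < 6 then 48 else 32) else 0)"
    unfolding upt_24 sum_less_24
    by (simp only: list.set ball_simps, intro conjI TrueI)
       (simp_all add: S4_fun_simps S4_dual_fun_simps pair_chr_def chr_def sign_S4_elem S4_elem_eval)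
  then show ?thesis using assms by simp
qed

lemma sum_S4: "(\<Sum>u\<in>S4. f u) = (\<Sum>n<24. f (S4_elem n))"
  by (rule sum.reindex_bij_betw[OF bij_betw_S4_elem, symmetric])

definition block_entry :: "((nat \<Rightarrow> nat) \<Rightarrow> int) \<Rightarrow> nat \<Rightarrow> nat \<Rightarrow> int" where
  "block_entry x r c = (\<Sum>u\<in>S4. x u * S4_coeff u r c)"

text \<open>The group matrix is the sum of \<open>x u\<close> times left translation by
  \<open>u\<close>, so the basis \<open>S4_fun\<close> turns it into the matrix of block entries.
  The base change \<open>V\<close> is invertible because \<open>W * V\<close> is diagonal with
  nonzero entries.\<close>

lemma group_det_eq_block_det:
  assumes "group_enumeration (sym_group 4) g"
  shows "group_det (sym_group 4) g x = det (mat 24 24 (\<lambda>(r, c). block_entry x r c))"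
proof -
  have order: "Coset.order (sym_group 4) = 24"
    using bij_betw_same_card[OF bij_betw_S4_elem] by (simp add: Coset.order_def sym_group_def)
  have g: "bij_betw g {..<24} S4"
    using assms unfolding group_enumeration_def order by (simp add: sym_group_def)
  then have gS: "g i \<in> S4" if "i < 24" for i
    using that bij_betwE by blast
  have sum_g: "(\<Sum>j<24. f (g j)) = (\<Sum>h\<in>S4. f h)" for f :: "(nat \<Rightarrow> nat) \<Rightarrow> int"
    by (rule sum.reindex_bij_betw[OF g])
  define M where "M = mat 24 24 (\<lambda>(i, j). x (g i \<circ> inv' (g j)))"
  define V where "V = mat 24 24 (\<lambda>(i, c). S4_fun c (g i))"
  define W where "W = mat 24 24 (\<lambda>(r, j). S4_dual_fun r (g j))"
  define B where "B = mat 24 24 (\<lambda>(r, c). block_entry x r c)"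
  have carrier: "M \<in> carrier_mat 24 24" "V \<in> carrier_mat 24 24" "W \<in> carrier_mat 24 24" "B \<in> carrier_mat 24 24"
    by (simp_all add: M_def V_def W_def B_def)
  have "group_matrix (sym_group 4) g x = M"
    unfolding group_matrix_def order M_def
    using gS by (intro eq_matI) (auto simp: sym_group_mult sym_group_inv_equality sym_group_carrier)
  then have det_M: "group_det (sym_group 4) g x = det M"
    by (simp add: group_det_def)
  have "M * V = V * B"
  proof (rule eq_matI)
    fix i c assume "i < dim_row (V * B)" "c < dim_col (V * B)"
    then have ic: "i < 24" "c < 24" using carrier by auto
    have gi: "g i permutes {1..4}" using gS[OF ic(1)] by simp
    have "(M * V) $$ (i, c) = (\<Sum>j<24. x (g i \<circ> inv' (g j)) * S4_fun c (g j))"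
      using ic by (simp add: M_def V_def scalar_prod_def atLeast0LessThan)
    also have "\<dots> = (\<Sum>h\<in>S4. x (g i \<circ> inv' h) * S4_fun c h)"
      by (rule sum_g)
    also have "\<dots> = (\<Sum>u\<in>S4. x u * S4_fun c (inv' u \<circ> g i))"
    proof (rule sum.reindex_bij_witness[of _ "\<lambda>u. inv' u \<circ> g i" "\<lambda>h. g i \<circ> inv' h"])
      fix h assume "h \<in> S4"
      then have h: "h permutes {1..4}" by simp
      show inv: "inv' (g i \<circ> inv' h) \<circ> g i = h"
        using permutes_bij[OF gi] permutes_bij[OF h] permutes_inv_o(2)[OF gi]
        by (simp add: o_inv_distrib bij_imp_bij_inv inv_inv_eq comp_assoc)
      show "g i \<circ> inv' h \<in> S4"
        using gi h by (simp add: permutes_compose permutes_inv)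
      show "x (g i \<circ> inv' h) * S4_fun c (inv' (g i \<circ> inv' h) \<circ> g i) = x (g i \<circ> inv' h) * S4_fun c h"
        unfolding inv ..
    next
      fix u assume "u \<in> S4"
      then have u: "u permutes {1..4}" by simp
      show "g i \<circ> inv' (inv' u \<circ> g i) = u"
        using permutes_bij[OF gi] permutes_bij[OF u] permutes_inv_o(1)[OF gi]
        by (simp add: o_inv_distrib bij_imp_bij_inv inv_inv_eq flip: comp_assoc)
      show "inv' u \<circ> g i \<in> S4"
        using gi u by (simp add: permutes_compose permutes_inv)
    qed
    also have "\<dots> = (\<Sum>u\<in>S4. x u * (\<Sum>r<24. S4_fun r (g i) * S4_coeff u r c))"
      using gS[OF ic(1)] ic(2) by (intro sum.cong refl arg_cong2[where f = "(*)"] S4_fun_translate)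
    also have "\<dots> = (\<Sum>r<24. S4_fun r (g i) * block_entry x r c)"
      unfolding block_entry_def sum_distrib_left by (subst sum.swap) (simp add: ac_simps)
    also have "\<dots> = (V * B) $$ (i, c)"
      using ic by (simp add: V_def B_def scalar_prod_def atLeast0LessThan)
    finally show "(M * V) $$ (i, c) = (V * B) $$ (i, c)" .
  qed (use carrier in auto)
  then have eq: "det M * det V = det V * det B"
    using carrier by (metis det_mult)
  have WV: "W * V = mat 24 24 (\<lambda>(r, c). if r = c then (if r < 2 then 24 else if r < 6 then 48 else 32) else 0)" (is "_ = ?D")
  proof (rule eq_matI)
    fix r c assume "r < dim_row ?D" "c < dim_col ?D"
    then have rc: "r < 24" "c < 24" by auto
    then have "(W * V) $$ (r, c) = (\<Sum>j<24. S4_dual_fun r (g j) * S4_fun c (g j))"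
      by (simp add: W_def V_def scalar_prod_def atLeast0LessThan)
    also have "\<dots> = (\<Sum>n<24. S4_dual_fun r (S4_elem n) * S4_fun c (S4_elem n))"
      unfolding sum_g[of "\<lambda>h. S4_dual_fun r h * S4_fun c h"] sum_S4 ..
    finally show "(W * V) $$ (r, c) = ?D $$ (r, c)"
      using rc by (simp add: S4_dual_fun_orthogonal)
  qed (use carrier in auto)
  have "det ?D = prod_list (diag_mat ?D)"
    by (rule det_upper_triangular[of _ 24]) (auto simp: upper_triangular_def)
  also have "\<dots> \<noteq> 0"
    by (auto simp: prod_list_zero_iff diag_mat_def split: if_splits)
  finally have "det W * det V \<noteq> 0"
    using WV det_mult[OF carrier(3,2)] by simp
  with eq show ?thesis
    unfolding det_M B_def by simp
qed

lemma block_entry_eq_0: "S4_block r \<noteq> S4_block c \<Longrightarrow> block_entry x r c = 0"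
  by (simp add: block_entry_def S4_coeff_def)

lemma S4_block_mono: "r \<le> c \<Longrightarrow> S4_block r \<le> S4_block c"
  unfolding S4_block_def by (auto split: if_splits intro: div_le_mono)

lemma det_block_entry_split:
  assumes "S4_block (a + k - 1) < S4_block (a + k)"
  shows "det (mat (k + n) (k + n) (\<lambda>(i, j). block_entry x (a + i) (a + j)))
    = det (mat k k (\<lambda>(i, j). block_entry x (a + i) (a + j)))
      * det (mat n n (\<lambda>(i, j). block_entry x (a + k + i) (a + k + j)))"
proof -
  have "S4_block (a + i) < S4_block (a + (k + j))" if "i < k" for i j
  proof -
    have "S4_block (a + i) \<le> S4_block (a + k - 1)"
      using that by (intro S4_block_mono) simp
    also note assms
    also have "S4_block (a + k) \<le> S4_block (a + (k + j))"
      by (intro S4_block_mono) simp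
    finally show ?thesis .
  qed
  then show ?thesis
    using det_mat_block_diag[of k n "\<lambda>i j. block_entry x (a + i) (a + j)"]
    by (simp add: block_entry_eq_0 add.assoc less_imp_neq[THEN not_sym] less_imp_neq)
qed

lemma det_block_entry:
  "det (mat 24 24 (\<lambda>(r, c). block_entry x r c)) = block_entry x 0 0 * block_entry x 1 1
    * (det (mat 2 2 (\<lambda>(i, j). block_entry x (2 + i) (2 + j))))\<^sup>2
    * (det (mat 3 3 (\<lambda>(i, j). block_entry x (6 + i) (6 + j))) * det (mat 3 3 (\<lambda>(i, j). block_entry x (15 + i) (15 + j)))) ^ 3"
proof -
  define b where "b = (\<lambda>a k. det (mat k k (\<lambda>(i, j). block_entry x (a + i) (a + j))))"
  have split: "b a (k + n) = b a k * b (a + k) n" if "S4_block (a + k - 1) < S4_block (a + k)" for a k n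
    unfolding b_def by (rule det_block_entry_split[OF that])
  have small: "b a 1 = block_entry x a a" for a
    by (simp add: b_def det_mat_1 del: One_nat_def)
  have coeff2: "block_entry x (4 + i) (4 + j) = block_entry x (2 + i) (2 + j)" if "i < 2" "j < 2" for i j
  proof -
    from that have "i = 0 \<or> i = 1" "j = 0 \<or> j = 1" by auto
    then show ?thesis by (elim disjE) (simp_all add: block_entry_def S4_coeff_def S4_block_def)
  qed
  have 2: "b 4 2 = b 2 2"
    unfolding b_def by (intro arg_cong[where f = det] eq_matI) (auto simp: coeff2)
  \<comment> \<open>\<open>m\<close> numbers the three copies of one representation. The copies of
    the standard representation start at index 6, those of its sign twist at 15.\<close>
  have coeff3: "block_entry x (a + 3 * m + i) (a + 3 * m + j) = block_entry x (a + i) (a + j)"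
    if "i < 3" "j < 3" "m < 3" "a \<in> {6, 15}" for i j m a
  proof -
    from that have "i = 0 \<or> i = 1 \<or> i = 2" "j = 0 \<or> j = 1 \<or> j = 2" "m = 0 \<or> m = 1 \<or> m = 2" "a = 6 \<or> a = 15"
      by auto
    then show ?thesis by (elim disjE) (simp_all add: block_entry_def S4_coeff_def S4_block_def)
  qed
  have 3: "b (a + 3 * m) 3 = b a 3" if "m < 3" "a \<in> {6, 15}" for a m
    unfolding b_def using that by (intro arg_cong[where f = det] eq_matI) (auto simp: coeff3)
  have "b 0 24 = b 0 1 * (b 1 1 * (b 2 2 * (b 4 2 * (b 6 3 * (b 9 3 * (b 12 3 * (b 15 3 * (b 18 3 * b 21 3))))))))"
    using split[of 0 1 23] split[of 1 1 22] split[of 2 2 20] split[of 4 2 18] split[of 6 3 15] split[of 9 3 12]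
      split[of 12 3 9] split[of 15 3 6] split[of 18 3 3]
    by (simp add: S4_block_def flip: numeral_2_eq_2)
  then show ?thesis
    unfolding small 2 using 3[of 1 6] 3[of 2 6] 3[of 1 15] 3[of 2 15]
    by (simp add: b_def power2_eq_square power3_eq_cube)
qed

section \<open>The group determinant as a product\<close>

definition coset_sum :: "(nat \<Rightarrow> int) \<Rightarrow> nat \<Rightarrow> int" where
  "coset_sum z s = z (4 * s) + z (4 * s + 1) + z (4 * s + 2) + z (4 * s + 3)"

definition coset_fourier :: "(nat \<Rightarrow> int) \<Rightarrow> nat \<Rightarrow> nat \<Rightarrow> int" where
  "coset_fourier z i s = z (4 * s) + chr 1 i * z (4 * s + 1) + chr 2 i * z (4 * s + 2) + chr 3 i * z (4 * s + 3)"

definition S4_det :: "(nat \<Rightarrow> int) \<Rightarrow> int" where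
  "S4_det z = (let c = coset_sum z; C = c 0 + c 1 + c 2; D = c 3 + c 4 + c 5;
       q = rot_form (c 0) (c 1) (c 2) - rot_form (c 3) (c 4) (c 5); F = coset_fourier z
     in (C\<^sup>2 - D\<^sup>2) * q\<^sup>2 * (mono_det 1 F * mono_det (-1) F) ^ 3)"

lemma group_det_S4:
  assumes "group_enumeration (sym_group 4) g"
  shows "group_det (sym_group 4) g x = S4_det (x \<circ> S4_elem)"
proof -
  define z where "z = x \<circ> S4_elem"
  have e: "block_entry x r c = (\<Sum>n<24. z n * S4_coeff (S4_elem n) r c)" for r c
    unfolding block_entry_def sum_S4 z_def comp_def ..
  define c where "c = coset_sum z"
  define C where "C = c 0 + c 1 + c 2"
  define D where "D = c 3 + c 4 + c 5"
  have 1: "block_entry x 0 0 * block_entry x 1 1 = C\<^sup>2 - D\<^sup>2"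
  proof -
    have "block_entry x 0 0 = C + D" "block_entry x 1 1 = C - D"
      unfolding e sum_less_24 by (simp_all add: S4_coeff_def S4_block_def sign_S4_elem C_def D_def c_def coset_sum_def
          flip: numeral_2_eq_2)
    then show ?thesis by (simp only: power2_eq_square square_diff_square_factored)
  qed
  have 2: "det (mat 2 2 (\<lambda>(i, j). block_entry x (2 + i) (2 + j))) = rot_form (c 0) (c 1) (c 2) - rot_form (c 3) (c 4) (c 5)"
  proof -
    \<comment> \<open>The Klein four-group acts trivially here, so the entries depend only on the
      coset \<open>n div 4\<close>.\<close>
    have plane: "plane_rep (S4_elem n) 1 1 = [1, -1, 0, 0, 1, -1] ! (n div 4)"
      "plane_rep (S4_elem n) 1 2 = [0, -1, 1, 1, 0, -1] ! (n div 4)"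
      "plane_rep (S4_elem n) 2 1 = [0, 1, -1, 1, -1, 0] ! (n div 4)"
      "plane_rep (S4_elem n) 2 2 = [1, 0, -1, 0, -1, 1] ! (n div 4)" if "n < 24" for n
    proof -
      have "\<forall>n\<in>set [0..<24]. plane_rep (S4_elem n) 1 1 = [1, -1, 0, 0, 1, -1] ! (n div 4)
          \<and> plane_rep (S4_elem n) 1 2 = [0, -1, 1, 1, 0, -1] ! (n div 4)
          \<and> plane_rep (S4_elem n) 2 1 = [0, 1, -1, 1, -1, 0] ! (n div 4)
          \<and> plane_rep (S4_elem n) 2 2 = [1, 0, -1, 0, -1, 1] ! (n div 4)"
        unfolding upt_24
        by (simp only: list.set ball_simps, intro conjI TrueI)
           (simp_all add: plane_rep_def std_rep_def chr_def S4_elem_eval)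
      then show "plane_rep (S4_elem n) 1 1 = [1, -1, 0, 0, 1, -1] ! (n div 4)"
        "plane_rep (S4_elem n) 1 2 = [0, -1, 1, 1, 0, -1] ! (n div 4)"
        "plane_rep (S4_elem n) 2 1 = [0, 1, -1, 1, -1, 0] ! (n div 4)"
        "plane_rep (S4_elem n) 2 2 = [1, 0, -1, 0, -1, 1] ! (n div 4)"
        using that by simp_all
    qed
    have be: "block_entry x 2 2 = c 0 - c 1 + c 4 - c 5" "block_entry x 2 3 = - c 1 + c 2 + c 3 - c 5"
      "block_entry x 3 2 = c 1 - c 2 + c 3 - c 4" "block_entry x 3 3 = c 0 - c 2 - c 4 + c 5"
      unfolding e sum_less_24
      by (simp_all add: S4_coeff_def S4_block_def plane[simplified] c_def coset_sum_def flip: numeral_2_eq_2)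
    have d: "det (mat 2 2 (\<lambda>(i, j). block_entry x (2 + i) (2 + j)))
        = block_entry x 2 2 * block_entry x 3 3 - block_entry x 2 3 * block_entry x 3 2"
      unfolding det_mat_2 by (simp flip: numeral_2_eq_2 numeral_3_eq_3)
    show ?thesis
      unfolding d be rot_form_def by (simp add: algebra_simps power2_eq_square)
  qed
  \<comment> \<open>Entry (i, j) is nonzero on one rotation coset and one reflection coset only, and
    there it is the character \<open>i\<close> at the translation \<open>n mod 4\<close>.\<close>
  have std_all: "\<forall>n\<in>set [0..<24]. \<forall>i\<in>{1, 2, 3}. \<forall>j\<in>{1, 2, 3}. std_rep (S4_elem n) i j =
      (if n div 4 = (i + 2 * j) mod 3 \<or> n div 4 = 3 + (2 * (i + j)) mod 3
       then [1, chr 1 i, chr 2 i, chr 3 i] ! (n mod 4) else 0)"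
    unfolding upt_24
    by (simp only: list.set ball_simps, intro conjI TrueI)
       (simp_all add: std_rep_def chr_def S4_elem_eval)
  have std: "std_rep (S4_elem n) i j =
      (if n div 4 = (i + 2 * j) mod 3 \<or> n div 4 = 3 + (2 * (i + j)) mod 3
       then [1, chr 1 i, chr 2 i, chr 3 i] ! (n mod 4) else 0)"
    if "n < 24" "i \<in> {1, 2, 3}" "j \<in> {1, 2, 3}" for n i j
  proof -
    have "n \<in> set [0..<24]" using that(1) by simp
    from std_all[rule_format, OF this that(2,3)] show ?thesis .
  qed
  have 3: "block_entry x (6 + i) (6 + j) = mono_row (coset_fourier z) False (i + 1) (j + 1) + mono_row (coset_fourier z) True (i + 1) (j + 1)"
     "block_entry x (15 + i) (15 + j) = mono_row (coset_fourier z) False (i + 1) (j + 1) - mono_row (coset_fourier z) True (i + 1) (j + 1)"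
    if "i < 3" "j < 3" for i j
  proof -
    from that have "i = 0 \<or> i = 1 \<or> i = 2" "j = 0 \<or> j = 1 \<or> j = 2" by auto
    then show "block_entry x (6 + i) (6 + j) = mono_row (coset_fourier z) False (i + 1) (j + 1) + mono_row (coset_fourier z) True (i + 1) (j + 1)"
     "block_entry x (15 + i) (15 + j) = mono_row (coset_fourier z) False (i + 1) (j + 1) - mono_row (coset_fourier z) True (i + 1) (j + 1)"
      unfolding e sum_less_24
      by (elim disjE; simp add: S4_coeff_def S4_block_def std sign_S4_elem mono_row_def coset_fourier_def
          mult.commute flip: numeral_2_eq_2)+
  qed
  have "mat 3 3 (\<lambda>(i, j). block_entry x (6 + i) (6 + j)) = mat 3 3 (\<lambda>(i, j).
      mono_row (coset_fourier z) False (i + 1) (j + 1) + mono_row (coset_fourier z) True (i + 1) (j + 1))"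
    "mat 3 3 (\<lambda>(i, j). block_entry x (15 + i) (15 + j)) = mat 3 3 (\<lambda>(i, j).
      mono_row (coset_fourier z) False (i + 1) (j + 1) - mono_row (coset_fourier z) True (i + 1) (j + 1))"
    by (intro eq_matI; simp add: 3 del: One_nat_def)+
  then have "det (mat 3 3 (\<lambda>(i, j). block_entry x (6 + i) (6 + j))) = mono_det 1 (coset_fourier z)"
    "det (mat 3 3 (\<lambda>(i, j). block_entry x (15 + i) (15 + j))) = mono_det (-1) (coset_fourier z)"
    by (simp_all add: det_mat_3 mono_det_def Let_def det3_def del: One_nat_def)
  with 1 2 show ?thesis
    unfolding group_det_eq_block_det[OF assms] det_block_entry z_def[symmetric] S4_det_def Let_def
    by (simp add: C_def D_def c_def)
qed

text \<open>Replacing a value -1 of a character by 1 costs twice the coordinate. Each nonzero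
  element of the Klein four-group has value -1 at exactly two of the three characters, so its
  coordinate occurs twice in the sum of the \<open>u i s\<close>.\<close>

lemma coset_fourier_eq:
  "\<exists>u. (\<forall>i s. coset_fourier z i s = coset_sum z s - 2 * u i s) \<and> (\<forall>s. even (u 1 s + u 2 s + u 3 s))"
proof (intro exI conjI allI)
  let ?u = "\<lambda>(i :: nat) s. (if i = 1 then 0 else z (4 * s + 1)) + (if i = 2 then 0 else z (4 * s + 2))
    + (if i = 3 then 0 else z (4 * s + 3))"
  show "coset_fourier z i s = coset_sum z s - 2 * ?u i s" for i s
    by (simp add: coset_fourier_def coset_sum_def chr_def)
  show "even (?u 1 s + ?u 2 s + ?u 3 s)" for s
    by simp
qed

lemma S4_det_2_part:
  "S4_det z mod 4 = 1 \<or> (\<exists>m. S4_det z = 2 ^ 8 * m \<and> m mod 4 = 1)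
    \<or> (\<exists>m. S4_det z = 2 ^ 10 * m \<and> m mod 4 = 3) \<or> 2 ^ 12 dvd S4_det z"
proof -
  obtain u where u: "\<And>i s. coset_fourier z i s = coset_sum z s - 2 * u i s" "\<And>s. even (u 1 s + u 2 s + u 3 s)"
    using coset_fourier_eq by blast
  obtain E O' f where *: "mono_det 1 (coset_fourier z) = E + O'" "mono_det (-1) (coset_fourier z) = E - O'"
    and cong: "[E = (coset_sum z 0 + coset_sum z 1 + coset_sum z 2) * (rot_form (coset_sum z 0) (coset_sum z 1) (coset_sum z 2)
          - rot_form (coset_sum z 3) (coset_sum z 4) (coset_sum z 5))
        + 2 * (coset_sum z 3 + coset_sum z 4 + coset_sum z 5) * f] (mod 4)"
      "[O' = (coset_sum z 3 + coset_sum z 4 + coset_sum z 5) * (rot_form (coset_sum z 0) (coset_sum z 1) (coset_sum z 2)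
          - rot_form (coset_sum z 3) (coset_sum z 4) (coset_sum z 5))
        + 2 * (coset_sum z 0 + coset_sum z 1 + coset_sum z 2) * f] (mod 4)"
    by (rule mono_det_parts_cong[OF u refl refl refl])
  have "(E + O') * (E - O') = E\<^sup>2 - O'\<^sup>2"
    by (simp add: power2_eq_square square_diff_square_factored)
  then show ?thesis
    by (intro det_power_2_part[OF cong]) (simp add: S4_det_def Let_def *)
qed

lemma S4_det_3_part: "3 dvd S4_det z \<Longrightarrow> 3 ^ 3 dvd S4_det z"
  unfolding S4_det_def Let_def by (rule det_power_3_part[OF refl refl refl])

lemma S4_det_cong: "(\<And>n. n < 24 \<Longrightarrow> z n = z' n) \<Longrightarrow> S4_det z = S4_det z'"
  by (simp add: S4_det_def coset_sum_def coset_fourier_def mono_det_def mono_row_def det3_def)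

lemma integer_group_dets_S4:
  assumes "group_enumeration (sym_group 4) g"
  shows "integer_group_dets (sym_group 4) g = range S4_det"
proof -
  have "S4_det z \<in> range (\<lambda>x. S4_det (x \<circ> S4_elem))" for z
  proof
    have "inj_on S4_elem {..<24}"
      using bij_betw_S4_elem by (rule bij_betw_imp_inj_on)
    then show "S4_det z = S4_det ((z \<circ> inv_into {..<24} S4_elem) \<circ> S4_elem)"
      by (intro S4_det_cong) simp
  qed simp
  then show ?thesis
    unfolding integer_group_dets_def using group_det_S4[OF assms] by auto
qed

section \<open>Realising the values\<close>

text \<open>\<open>S4_det\<close> without the factor of the trivial character.\<close>

definition S4_cofactor :: "(nat \<Rightarrow> int) \<Rightarrow> int" where
  "S4_cofactor z = (let c = coset_sum z; F = coset_fourier z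
     in (c 0 + c 1 + c 2 - (c 3 + c 4 + c 5)) * (rot_form (c 0) (c 1) (c 2) - rot_form (c 3) (c 4) (c 5))\<^sup>2
        * (mono_det 1 F * mono_det (-1) F) ^ 3)"

text \<open>A constant raises every coset sum by 4 k. This cancels in C - D, in
  \<open>rot_form\<close> and in the nontrivial Fourier coefficients.\<close>

lemma S4_det_shift: "S4_det (\<lambda>n. z n + k) = ((\<Sum>s<6. coset_sum z s) + 24 * k) * S4_cofactor z"
proof -
  have sum: "coset_sum (\<lambda>n. z n + k) s = coset_sum z s + 4 * k" for s
    by (simp add: coset_sum_def)
  have "coset_fourier (\<lambda>n. z n + k) i s = coset_fourier z i s" if "i \<in> {1, 2, 3}" for i s
    using that by (auto simp: coset_fourier_def chr_def)
  then have "mono_det \<epsilon> (coset_fourier (\<lambda>n. z n + k)) = mono_det \<epsilon> (coset_fourier z)" for \<epsilon>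
    by (simp add: mono_det_def mono_row_def Let_def)
  moreover have "rot_form (a + t) (b + t) (c + t) = rot_form a b c" for a b c t
    by (simp add: rot_form_def power2_eq_square algebra_simps)
  moreover have "(a + 4 * k + (b + 4 * k) + (c + 4 * k))\<^sup>2 - (d + 4 * k + (e + 4 * k) + (f + 4 * k))\<^sup>2
      = (a + b + c + d + e + f + 24 * k) * (a + b + c - (d + e + f))" for a b c d e f
    by (simp add: power2_eq_square algebra_simps)
  moreover have "(\<Sum>s<6. f s) = f 0 + f 1 + f 2 + f 3 + f 4 + f 5" for f :: "nat \<Rightarrow> int"
    by (simp add: eval_nat_numeral)
  ultimately show ?thesis
    unfolding S4_det_def S4_cofactor_def Let_def sum by (simp only: mult.assoc)
qed

text \<open>A shift makes the trivial character take the value \<open>m\<close> exactly, so its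
  value \<open>a\<close> at \<open>w\<close> matters only modulo 24 and may be negative.\<close>

lemma S4_det_shift_family:
  assumes "(\<Sum>s<6. coset_sum (nth w) s) = a" "S4_cofactor (nth w) = b" "m mod 24 = a mod 24"
  shows "b * m \<in> range S4_det"
proof -
  have "24 dvd m - a"
    using assms(3) by (simp add: mod_eq_dvd_iff)
  then have "m = a + 24 * ((m - a) div 24)"
    by simp
  then have "b * m = S4_det (\<lambda>n. w ! n + (m - a) div 24)"
    unfolding S4_det_shift assms by (simp add: mult.commute)
  then show ?thesis by blast
qed

lemmas S4_eval_defs = S4_cofactor_def coset_sum_def coset_fourier_def chr_def mono_det_def mono_row_def det3_def
  rot_form_def lessThan_nat_numeral

text \<open>The assignments in the following families were found by a computer search.\<close>

lemma S4_det_family_1: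
  assumes "m mod 24 \<in> {1, 5, 13, 17}"
  shows "1 * m \<in> range S4_det"
proof -
  from assms consider "m mod 24 = 1" | "m mod 24 = 5" | "m mod 24 = 13" | "m mod 24 = 17"
    by auto
  then show ?thesis
  proof cases
    case 1
    then show ?thesis
      by (intro S4_det_shift_family[of "[0, 0, 0, 1, 0, 0, 0, 0, 0, 0, 0, 0, 0, 0, 0, 0, 0, 0, 0, 0, 0, 0, 0, 0]" "1"])
         (simp_all add: S4_eval_defs)
  next
    case 2
    then show ?thesis
      by (intro S4_det_shift_family[of "[0, 1, 1, 0, 0, 0, 0, 0, 0, 0, 0, 0, 1, 1, 0, 0, 0, 0, 0, 1, 0, 0, 0, 0]" "5"])
         (simp_all add: S4_eval_defs)
  next
    case 3
    then show ?thesis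
      by (intro S4_det_shift_family[of "[0, -1, 0, -1, 0, -1, 0, -1, 0, -1, -1, 0, 0, -1, 0, -1, 0, -1, 0, 0, 0, -1, -1, 0]" "-11"])
         (simp_all add: S4_eval_defs)
  next
    case 4
    then show ?thesis
      by (intro S4_det_shift_family[of "[-1, 0, -1, 0, 0, 0, 0, 0, -1, 0, -1, 0, -1, 0, 0, 0, 0, -1, -1, 0, 0, 0, 0, 0]" "-7"])
         (simp_all add: S4_eval_defs)
  qed
qed

lemma S4_det_family_9:
  assumes "m mod 24 \<in> {9, 21}"
  shows "9 * m \<in> range S4_det"
proof -
  from assms consider "m mod 24 = 9" | "m mod 24 = 21"
    by auto
  then show ?thesis
  proof cases
    case 1
    then show ?thesis
      by (intro S4_det_shift_family[of "[0, 1, 0, 0, 0, 0, 1, 0, 1, 1, 1, 0, 0, 1, 1, 1, 0, 0, 0, 0, 0, 0, 1, 0]" "9"])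
         (simp_all add: S4_eval_defs)
  next
    case 2
    then show ?thesis
      by (intro S4_det_shift_family[of "[0, 0, 0, 0, 0, 0, 0, -1, 0, 0, 0, 0, 0, 0, 0, 0, 0, -1, 0, -1, 0, 0, 0, 0]" "-3"])
         (simp_all add: S4_eval_defs)
  qed
qed

lemma S4_det_family_128:
  assumes "m mod 24 \<in> {2, 10}"
  shows "128 * m \<in> range S4_det"
proof -
  from assms consider "m mod 24 = 2" | "m mod 24 = 10"
    by auto
  then show ?thesis
  proof cases
    case 1
    then show ?thesis
      by (intro S4_det_shift_family[of "[0, 0, 0, 0, 0, 0, 0, 0, 0, 0, 0, 0, 0, 0, 0, 1, 0, 0, 1, 0, 0, 0, 0, 0]" "2"])
         (simp_all add: S4_eval_defs)
  next
    case 2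
    then show ?thesis
      by (intro S4_det_shift_family[of "[1, 0, 0, 0, 0, 0, 1, 0, 1, 0, 0, 1, 0, 1, 0, 1, 0, 1, 1, 0, 0, 1, 1, 0]" "10"])
         (simp_all add: S4_eval_defs)
  qed
qed

lemma S4_det_family_1152:
  assumes "m mod 24 \<in> {18}"
  shows "1152 * m \<in> range S4_det"
  using assms
  by (intro S4_det_shift_family[of "[-1, 0, 0, -1, -1, -1, 0, 0, 0, 0, 0, 0, 0, 0, 0, 0, 0, 0, 0, -1, 0, 0, -1, 0]" "-6"])
     (simp_all add: S4_eval_defs)

lemma S4_det_family_1024:
  assumes "m mod 24 \<in> {4, 7, 8, 11, 16, 19, 20, 23}"
  shows "1024 * m \<in> range S4_det"
proof -
  from assms consider "m mod 24 = 4" | "m mod 24 = 7" | "m mod 24 = 8" | "m mod 24 = 11" | "m mod 24 = 16" | "m mod 24 = 19" | "m mod 24 = 20" | "m mod 24 = 23"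
    by auto
  then show ?thesis
  proof cases
    case 1
    then show ?thesis
      by (intro S4_det_shift_family[of "[1, 0, 0, 0, 0, 0, 0, 0, 0, 0, 0, 0, 1, 0, 0, 0, 1, 0, 0, 0, 0, 1, 0, 0]" "4"])
         (simp_all add: S4_eval_defs)
  next
    case 2
    then show ?thesis
      by (intro S4_det_shift_family[of "[0, 1, 1, 0, 0, 0, 0, 1, 0, 0, 0, 0, 0, 0, 0, 1, 0, 1, 1, 1, 0, 0, 0, 0]" "7"])
         (simp_all add: S4_eval_defs)
  next
    case 3
    then show ?thesis
      by (intro S4_det_shift_family[of "[1, 0, 1, 0, 0, 0, 0, 0, 1, 0, 0, 0, 0, 0, 0, 1, 1, 0, 1, 1, 0, 0, 0, 1]" "8"])
         (simp_all add: S4_eval_defs)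
  next
    case 4
    then show ?thesis
      by (intro S4_det_shift_family[of "[1, 0, 1, 0, 1, 1, 0, 1, 0, 0, 0, 0, 1, 1, 1, 0, 0, 1, 0, 0, 1, 1, 0, 0]" "11"])
         (simp_all add: S4_eval_defs)
  next
    case 5
    then show ?thesis
      by (intro S4_det_shift_family[of "[0, -1, 0, 0, 0, 0, 0, -1, -1, 0, 0, 0, -1, 0, -1, 0, -1, 0, -1, 0, 0, 0, 0, -1]" "-8"])
         (simp_all add: S4_eval_defs)
  next
    case 6
    then show ?thesis
      by (intro S4_det_shift_family[of "[0, 0, -1, 0, 0, -1, -1, 0, 0, 0, 0, 0, 0, 0, -1, 0, -1, -1, 0, 0, 0, 1, 0, 0]" "-5"])
         (simp_all add: S4_eval_defs)
  next
    case 7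
    then show ?thesis
      by (intro S4_det_shift_family[of "[0, 0, 0, 0, 0, -1, 0, 0, -1, 0, -1, 0, 0, 1, 0, 0, 0, 0, 0, -1, -1, 0, 0, 0]" "-4"])
         (simp_all add: S4_eval_defs)
  next
    case 8
    then show ?thesis
      by (intro S4_det_shift_family[of "[0, 1, 0, 0, 0, 0, -1, -1, 0, 0, 0, 0, 0, 0, 0, 0, 0, 0, 0, 1, -1, 0, 0, 0]" "-1"])
         (simp_all add: S4_eval_defs)
  qed
qed

lemma S4_det_family_9216:
  assumes "m mod 24 \<in> {0, 3, 12, 15}"
  shows "9216 * m \<in> range S4_det"
proof -
  from assms consider "m mod 24 = 0" | "m mod 24 = 3" | "m mod 24 = 12" | "m mod 24 = 15"
    by auto
  then show ?thesis
  proof cases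
    case 1
    then show ?thesis
      by (intro S4_det_shift_family[of "[0, 0, 0, 0, 0, 0, 1, 0, 0, 0, 0, 0, 0, 0, 0, 1, -1, 0, 0, 0, -1, 0, 0, 0]" "0"])
         (simp_all add: S4_eval_defs)
  next
    case 2
    then show ?thesis
      by (intro S4_det_shift_family[of "[1, 0, 1, 1, -1, 0, 0, 0, 0, 0, 0, 0, 0, 0, 0, 0, 0, 0, 0, 0, 0, 0, 0, 1]" "3"])
         (simp_all add: S4_eval_defs)
  next
    case 3
    then show ?thesis
      by (intro S4_det_shift_family[of "[1, 0, 0, 0, 1, 0, 1, 1, 1, 1, 0, 1, 1, 0, 1, 0, 1, 0, 0, 0, 1, 1, 0, 0]" "12"])
         (simp_all add: S4_eval_defs)
  next
    case 4
    then show ?thesis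
      by (intro S4_det_shift_family[of "[-1, -1, -1, -1, 0, 0, 0, 0, 0, 0, -1, 0, 0, 0, -1, -1, 0, 0, -1, 0, 0, 0, 0, -1]" "-9"])
         (simp_all add: S4_eval_defs)
  qed
qed

section \<open>The two inclusions for the set of values\<close>

lemma three_part_cancel:
  fixes k m :: int
  assumes "3 dvd k * m \<Longrightarrow> 3 ^ 3 dvd k * m" "coprime 3 k"
  shows "\<not> 3 dvd m \<or> 3 ^ 3 dvd m"
  using assms by (metis coprime_dvd_mult_right_iff coprime_power_left_iff)

lemma range_S4_det_subset:
  assumes "d \<in> range S4_det"
  shows "d mod 4 = 1 \<and> (\<not> 3 dvd d \<or> 3 ^ 3 dvd d)
    \<or> (\<exists>m. d = 2 ^ 8 * m \<and> m mod 4 = 1 \<and> (\<not> 3 dvd m \<or> 3 ^ 3 dvd m))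
    \<or> (\<exists>m. d = 2 ^ 10 * m \<and> m mod 4 = 3 \<and> (\<not> 3 dvd m \<or> 3 ^ 3 dvd m))
    \<or> (\<exists>m. d = 2 ^ 12 * m \<and> (\<not> 3 dvd m \<or> 3 ^ 3 dvd m))"
proof -
  obtain z where d: "d = S4_det z" using assms by blast
  have 3: "\<not> 3 dvd m \<or> 3 ^ 3 dvd m" if "d = k * m" "coprime 3 k" for k m :: int
    using that S4_det_3_part[of z] by (intro three_part_cancel[of k]) (simp_all add: d)
  have "coprime 3 ((2 :: int) ^ n)" for n
    by (rule coprime_power_right_iff[THEN iffD2]) simp
  then have two: "\<not> 3 dvd m \<or> 3 ^ 3 dvd m" if "d = 2 ^ n * m" for n m
    using 3[of "2 ^ n" m] that by blast
  consider "d mod 4 = 1" | m where "d = 2 ^ 8 * m" "m mod 4 = 1" | m where "d = 2 ^ 10 * m" "m mod 4 = 3"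
    | m where "d = 2 ^ 12 * m"
    using S4_det_2_part[of z] unfolding d[symmetric] dvd_def by blast
  then show ?thesis
    using 3[of 1 d] two by cases (simp, blast+)
qed

text \<open>Each value is split as cofactor times trivial character. For \<open>m\<close> prime to 3
  the splittings are 1 * m, 128 * 2m, 1024 * m and 1024 * 4m; for m = 27 t they are 9 * 3t, 1152 *
  6t, 9216 * 3t and 9216 * 12t.\<close>

lemma range_S4_det_supset:
  assumes "\<not> 3 dvd m \<or> 3 ^ 3 dvd m"
  shows "m mod 4 = 1 \<Longrightarrow> m \<in> range S4_det"
    and "m mod 4 = 1 \<Longrightarrow> 2 ^ 8 * m \<in> range S4_det"
    and "m mod 4 = 3 \<Longrightarrow> 2 ^ 10 * m \<in> range S4_det"
    and "2 ^ 12 * m \<in> range S4_det"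
proof -
  have "(m mod 4 = 1 \<longrightarrow> m \<in> range S4_det) \<and> (m mod 4 = 1 \<longrightarrow> 2 ^ 8 * m \<in> range S4_det)
    \<and> (m mod 4 = 3 \<longrightarrow> 2 ^ 10 * m \<in> range S4_det) \<and> 2 ^ 12 * m \<in> range S4_det"
  proof (cases "3 dvd m")
    case False
    define r where "r = m mod 24"
    have r: "m mod 4 = r mod 4" "3 dvd m \<longleftrightarrow> 3 dvd r" "(2 * m) mod 24 = (2 * r) mod 24" "(4 * m) mod 24 = (4 * r) mod 24"
      by (simp_all add: r_def mod_mod_cancel dvd_mod_iff mod_mult_right_eq)
    have "\<forall>r\<in>set [0..23 :: int]. \<not> 3 dvd r \<longrightarrow>
        (r mod 4 = 1 \<longrightarrow> r \<in> {1, 5, 13, 17} \<and> (2 * r) mod 24 \<in> {2, 10})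
        \<and> (r mod 4 = 3 \<longrightarrow> r \<in> {4, 7, 8, 11, 16, 19, 20, 23}) \<and> (4 * r) mod 24 \<in> {4, 7, 8, 11, 16, 19, 20, 23}"
      by (simp add: upto.simps del: set_upto)
    moreover have "r \<in> set [0..23]"
      by (simp add: r_def)
    ultimately have "(r mod 4 = 1 \<longrightarrow> r \<in> {1, 5, 13, 17} \<and> (2 * r) mod 24 \<in> {2, 10})
        \<and> (r mod 4 = 3 \<longrightarrow> r \<in> {4, 7, 8, 11, 16, 19, 20, 23}) \<and> (4 * r) mod 24 \<in> {4, 7, 8, 11, 16, 19, 20, 23}"
      using False unfolding r by blast
    then have "m mod 4 = 1 \<longrightarrow> m mod 24 \<in> {1, 5, 13, 17} \<and> (2 * m) mod 24 \<in> {2, 10}"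
      "m mod 4 = 3 \<longrightarrow> m mod 24 \<in> {4, 7, 8, 11, 16, 19, 20, 23}" "(4 * m) mod 24 \<in> {4, 7, 8, 11, 16, 19, 20, 23}"
      unfolding r r_def[symmetric] by blast+
    then show ?thesis
      using S4_det_family_1[of m] S4_det_family_128[of "2 * m"] S4_det_family_1024[of m]
        S4_det_family_1024[of "4 * m"] by simp
  next
    case True
    then obtain t where t: "m = 27 * t" using assms by auto
    \<comment> \<open>Since 3 * 8 = 24, the residues of 3t, 6t, 12t modulo 24 and of 27t modulo 4
      depend only on t modulo 8.\<close>
    define r s where "r = t mod 8" and "s = t div 8"
    have "t = r + 8 * s"
      by (simp add: r_def s_def)
    then have "27 * t = 27 * r + 4 * (54 * s)" "3 * t = 3 * r + 24 * s" "6 * t = 6 * r + 24 * (2 * s)"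
      "12 * t = 12 * r + 24 * (4 * s)"
      by simp_all
    then have r: "m mod 4 = (27 * r) mod 4" "(3 * t) mod 24 = (3 * r) mod 24" "(6 * t) mod 24 = (6 * r) mod 24"
      "(12 * t) mod 24 = (12 * r) mod 24"
      by (simp_all only: t mod_mult_self2)
    have "\<forall>r\<in>set [0..7 :: int]. ((27 * r) mod 4 = 1 \<longrightarrow> (3 * r) mod 24 \<in> {9, 21} \<and> (6 * r) mod 24 \<in> {18})
        \<and> ((27 * r) mod 4 = 3 \<longrightarrow> (3 * r) mod 24 \<in> {0, 3, 12, 15}) \<and> (12 * r) mod 24 \<in> {0, 3, 12, 15}"
      by (simp add: upto.simps del: set_upto)
    moreover have "r \<in> set [0..7]"
      by (simp add: r_def)
    ultimately have "m mod 4 = 1 \<longrightarrow> (3 * t) mod 24 \<in> {9, 21} \<and> (6 * t) mod 24 \<in> {18}"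
      "m mod 4 = 3 \<longrightarrow> (3 * t) mod 24 \<in> {0, 3, 12, 15}" "(12 * t) mod 24 \<in> {0, 3, 12, 15}"
      unfolding r by blast+
    then show ?thesis
      using S4_det_family_9[of "3 * t"] S4_det_family_1152[of "6 * t"] S4_det_family_9216[of "3 * t"]
        S4_det_family_9216[of "12 * t"] by (simp add: t)
  qed
  then show "m mod 4 = 1 \<Longrightarrow> m \<in> range S4_det" "m mod 4 = 1 \<Longrightarrow> 2 ^ 8 * m \<in> range S4_det"
    "m mod 4 = 3 \<Longrightarrow> 2 ^ 10 * m \<in> range S4_det" "2 ^ 12 * m \<in> range S4_det"
    by blast+
qed

theorem theorem1:
  fixes g :: "nat \<Rightarrow> (nat \<Rightarrow> nat)"
  assumes "group_enumeration (sym_group 4) g"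
  shows "{d \<in> integer_group_dets (sym_group 4) g. odd d} =
           {m. [m = 1] (mod 4) \<and> (\<not> 3 dvd m \<or> 3 ^ 3 dvd m)} \<and>
         {d \<in> integer_group_dets (sym_group 4) g. even d} =
           {2 ^ 8 * m | m. [m = 1] (mod 4) \<and> (\<not> 3 dvd m \<or> 3 ^ 3 dvd m)} \<union>
           {2 ^ 10 * m | m. [m = -1] (mod 4) \<and> (\<not> 3 dvd m \<or> 3 ^ 3 dvd m)} \<union>
           {2 ^ 12 * m | m. \<not> 3 dvd m \<or> 3 ^ 3 dvd m}"
proof -
  have mod4: "[m = 1] (mod 4) \<longleftrightarrow> m mod 4 = 1" "[m = -1] (mod 4) \<longleftrightarrow> m mod 4 = 3" for m :: int
    by (simp_all add: cong_def)
  have odd: "odd m" if "m mod 4 = 1" for m :: int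
    using that by presburger
  show ?thesis
    unfolding integer_group_dets_S4[OF assms] mod4
  proof (intro conjI subset_antisym subsetI)
    fix d assume "d \<in> {d \<in> range S4_det. odd d}"
    then show "d \<in> {m. m mod 4 = 1 \<and> (\<not> 3 dvd m \<or> 3 ^ 3 dvd m)}"
      using range_S4_det_subset[of d] by auto
  next
    fix d :: int assume "d \<in> {m. m mod 4 = 1 \<and> (\<not> 3 dvd m \<or> 3 ^ 3 dvd m)}"
    then show "d \<in> {d \<in> range S4_det. odd d}"
      using range_S4_det_supset(1)[of d] odd[of d] by blast
  next
    fix d assume "d \<in> {d \<in> range S4_det. even d}"
    then show "d \<in> {2 ^ 8 * m | m. m mod 4 = 1 \<and> (\<not> 3 dvd m \<or> 3 ^ 3 dvd m)} \<union>
           {2 ^ 10 * m | m. m mod 4 = 3 \<and> (\<not> 3 dvd m \<or> 3 ^ 3 dvd m)} \<union>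
           {2 ^ 12 * m | m. \<not> 3 dvd m \<or> 3 ^ 3 dvd m}"
      using range_S4_det_subset[of d] odd[of d] by blast
  next
    fix d :: int assume "d \<in> {2 ^ 8 * m | m. m mod 4 = 1 \<and> (\<not> 3 dvd m \<or> 3 ^ 3 dvd m)} \<union>
           {2 ^ 10 * m | m. m mod 4 = 3 \<and> (\<not> 3 dvd m \<or> 3 ^ 3 dvd m)} \<union>
           {2 ^ 12 * m | m. \<not> 3 dvd m \<or> 3 ^ 3 dvd m}"
    then consider (1) m where "d = 2 ^ 8 * m" "m mod 4 = 1" "\<not> 3 dvd m \<or> 3 ^ 3 dvd m"
      | (2) m where "d = 2 ^ 10 * m" "m mod 4 = 3" "\<not> 3 dvd m \<or> 3 ^ 3 dvd m"
      | (3) m where "d = 2 ^ 12 * m" "\<not> 3 dvd m \<or> 3 ^ 3 dvd m"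
      by blast
    then show "d \<in> {d \<in> range S4_det. even d}"
    proof cases
      case 1
      then show ?thesis using range_S4_det_supset(2)[of m] by simp
    next
      case 2
      then show ?thesis using range_S4_det_supset(3)[of m] by simp
    next
      case 3
      then show ?thesis using range_S4_det_supset(4)[of m] by simp
    qed
  qed
qed

end
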